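(* Let $p,q\in\mathcal{PV}$ and $\Gamma\subseteq\mathcal{A}$. The function $solve_\phi(\mathcal{V}_M)$ is (i) positive monotonic w.r.t. $VB$ for $\phi\in\{p,\ p\wedge q,\ \langle\langle\Gamma\rangle\rangle\mathrm{X}p,\ \langle\langle\Gamma\rangle\rangle\mathrm{G}p,\ \langle\langle\Gamma\rangle\rangle p\mathrm{U}q\}$; (ii) negative monotonic w.r.t. $VB$ for $\phi=\neg p$; (iii) positive and negative monotonic w.r.t. $TB_i$ for $i\in\mathcal{A}$ if $\phi\in\{p,\neg p,p\wedge q\}$; (iv) positive monotonic w.r.t. $TB_i$ for each $i\in\Gamma$ if $\phi\in\{\langle\langle\Gamma\rangle\rangle\mathrm{X}p,\ \langle\langle\Gamma\rangle\rangle\mathrm{G}p,\ \langle\langle\Gamma\rangle\rangle p\mathrm{U}q\}$; (v) negative monotonic w.r.t. $TB_i$ for $i\in\mathcal{A}\setminus\Gamma$ if $\phi\in\{\langle\langle\Gamma\rangle\rangle\mathrm{X}p,\ \langle\langle\Gamma\rangle\rangle\mathrm{G}p,\ \langle\langle\Gamma\rangle\rangle p\mathrm{U}q\}$.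
   Context: Fix a set of agents $\mathcal{A}=\{1,\dots,n\}$, a finite set $\mathcal{PV}$ of propositional variables, and for each agent $i$ a finite set of local states $L_i=\{l_i^1,\dots,l_i^{n_i}\}$. Agent $i$ has actions $Act_i=\{a_i^1,\dots,a_i^{n_i}\}$ and a local protocol $P_i:L_i\to 2^{Act_i}$ with $P_i(l)\neq\emptyset$ for all $l$; its local transition function is $T_i(l_i^k,a_i^j)=l_i^j$, defined iff $a_i^j\in P_i(l_i^k)$. A model is $M=(St,T,V)$ with $St=L_1\times\dots\times L_n$, global actions $Act=Act_1\times\dots\times Act_n$, global transition $T(g,a)=g'$ iff $T_i(g^i,a^i)=g'^i$ for all $i$ (superscript $i$ denotes the $i$-th component), and valuation $V:St\to 2^{\mathcal{PV}}$. Encoding: $P_i$ is a Boolean $n_i\times n_i$ table (entry $(l,a)$ is $1$ iff $a\in P_i(l)$) flattened into $tb_i$; $V$ is a bit vector $vb$ of length $|St|\cdot|\mathcal{PV}|$ (entry $(g,p)$ is $1$ iff $p\in V(g)$). The model is encoded by $v_M=(tb_1,\dots,tb_n,vb)$; $\mathcal{V}_M=(TB_1,\dots,TB_n,VB)$ is the corresponding vector of Boolean variables; only vectors encoding models (each local state has at least one available action) are considered. A path from $g$ is $g_0a_0g_1a_1\dots$ with $g_0=g$, $T(g_k,a_k)=g_{k+1}$; $\pi[k]=g_k$. A strategy of agent $i$ is $\sigma_i:St\to Act_i$ with $\sigma_i(g)\in P_i(g^i)$; a joint strategy $\sigma_\Gamma$ is a tuple of strategies of agents in $\Gamma$; $out_M(g,\sigma_\Gamma)$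 is the set of paths from $g$ with $a_k^j=\sigma_j(g_k)$ for all $k$ and $j\in\Gamma$. ATL semantics: $M,g\models p$ iff $p\in V(g)$; Boolean connectives as usual; $M,g\models\langle\langle\Gamma\rangle\rangle\mathrm{X}\varphi$ iff there is $\sigma_\Gamma$ with $out_M(g,\sigma_\Gamma)\neq\emptyset$ and $M,\pi[1]\models\varphi$ for every $\pi$ in it; $M,g\models\langle\langle\Gamma\rangle\rangle\varphi_1\mathrm{U}\varphi_2$ iff there is $\sigma_\Gamma$ with nonempty outcome such that every $\pi$ in it has $i\ge0$ with $M,\pi[i]\models\varphi_2$ and $M,\pi[j]\models\varphi_1$ for $j<i$; $M,g\models\langle\langle\Gamma\rangle\rangle\mathrm{G}\varphi$ iff there is $\sigma_\Gamma$ with nonempty outcome such that $M,\pi[i]\models\varphi$ for all $i\ge0$ and all $\pi$ in it. $solve_\phi(v_M)=\{g\in St: M,g\models\phi\}$ for the model $M$ encoded by $v_M$. A set-valued function $F$ of bit vectors is positive (resp. negative) monotonic w.r.t. a set $W$ of its variables if changing any single variable of $W$ from $0$ to $1$ (resp. from $1$ to $0$), others fixed, yields a value $\supseteq$ the original value. *)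

theory Defs
  imports Main "HOL-Library.FuncSet"
begin

record 'p frame =
  nagents :: nat
  nlocal :: "nat \<Rightarrow> nat"
  props :: "'p set"

text \<open>The local state $l_i^k$ and the action $a_i^j$ are represented by their upper indices
  $k$ and $j$; the agent $i$ is always clear from the position in which they occur.
  Global states and global actions are tuples indexed by the agents.\<close>

type_synonym lstate = nat
type_synonym laction = nat
type_synonym gstate = "nat \<Rightarrow> lstate"
type_synonym gaction = "nat \<Rightarrow> laction"

definition agents :: "'p frame \<Rightarrow> nat set" where
  "agents F = {1..nagents F}"

definition lstates :: "'p frame \<Rightarrow> nat \<Rightarrow> lstate set" where
  "lstates F i = {1..nlocal F i}"

definition lactions :: "'p frame \<Rightarrow> nat \<Rightarrow> laction set" where
  "lactions F i = {1..nlocal F i}"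

definition gstates :: "'p frame \<Rightarrow> gstate set" where
  "gstates F = (\<Pi>\<^sub>E i\<in>agents F. lstates F i)"

definition gactions :: "'p frame \<Rightarrow> gaction set" where
  "gactions F = (\<Pi>\<^sub>E i\<in>agents F. lactions F i)"

text \<open>A model is determined by its protocols and its valuation: the set of global states is fixed
  by the frame, and the transition function is derived from the protocols. All components are
  extensional functions, so that a model is determined by its encoding.\<close>

record 'p model =
  prot :: "nat \<Rightarrow> lstate \<Rightarrow> laction set"
  val :: "gstate \<Rightarrow> 'p set"

definition models :: "'p frame \<Rightarrow> 'p model set" where
  "models F = {M. prot M \<in> (\<Pi>\<^sub>E i\<in>agents F. \<Pi>\<^sub>E l\<in>lstates F i. Pow (lactions F i) - {{}})
                \<and> val M \<in> gstates F \<rightarrow>\<^sub>E Pow (props F)}"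

definition ltrans :: "'p model \<Rightarrow> nat \<Rightarrow> lstate \<Rightarrow> laction \<Rightarrow> lstate option" where
  "ltrans M i k j = (if j \<in> prot M i k then Some j else None)"

text \<open>The graph of the (partial) global transition function: $T(g,a)=g'$.\<close>

definition gtrans :: "'p frame \<Rightarrow> 'p model \<Rightarrow> gstate \<Rightarrow> gaction \<Rightarrow> gstate \<Rightarrow> bool" where
  "gtrans F M g a g' \<longleftrightarrow> g \<in> gstates F \<and> a \<in> gactions F \<and> g' \<in> gstates F
     \<and> (\<forall>i\<in>agents F. ltrans M i (g i) (a i) = Some (g' i))"

text \<open>A path $g_0a_0g_1a_1\dots$ is the pair of its state sequence and its action sequence.\<close>

type_synonym path = "(nat \<Rightarrow> gstate) \<times> (nat \<Rightarrow> gaction)"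

definition paths :: "'p frame \<Rightarrow> 'p model \<Rightarrow> gstate \<Rightarrow> path set" where
  "paths F M g = {(gs, as). gs 0 = g \<and> (\<forall>k. gtrans F M (gs k) (as k) (gs (Suc k)))}"

definition strategies :: "'p frame \<Rightarrow> 'p model \<Rightarrow> nat \<Rightarrow> (gstate \<Rightarrow> laction) set" where
  "strategies F M i = {s \<in> gstates F \<rightarrow>\<^sub>E lactions F i. \<forall>g\<in>gstates F. s g \<in> prot M i (g i)}"

definition joint_strategies ::
    "'p frame \<Rightarrow> 'p model \<Rightarrow> nat set \<Rightarrow> (nat \<Rightarrow> gstate \<Rightarrow> laction) set" where
  "joint_strategies F M \<Gamma> = (\<Pi>\<^sub>E i\<in>\<Gamma>. strategies F M i)"

definition outcomes ::
    "'p frame \<Rightarrow> 'p model \<Rightarrow> gstate \<Rightarrow> nat set \<Rightarrow> (nat \<Rightarrow> gstate \<Rightarrow> laction) \<Rightarrow> path set" where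
  "outcomes F M g \<Gamma> \<sigma> = {(gs, as) \<in> paths F M g. \<forall>k. \<forall>j\<in>\<Gamma>. as k j = \<sigma> j (gs k)}"

datatype 'p atl =
    Prop 'p
  | Neg "'p atl"
  | Conj "'p atl" "'p atl"
  | Next "nat set" "'p atl"
  | Globally "nat set" "'p atl"
  | Until "nat set" "'p atl" "'p atl"

fun sat :: "'p frame \<Rightarrow> 'p model \<Rightarrow> gstate \<Rightarrow> 'p atl \<Rightarrow> bool" where
  "sat F M g (Prop p) \<longleftrightarrow> p \<in> val M g"
| "sat F M g (Neg \<phi>) \<longleftrightarrow> \<not> sat F M g \<phi>"
| "sat F M g (Conj \<phi> \<psi>) \<longleftrightarrow> sat F M g \<phi> \<and> sat F M g \<psi>"
| "sat F M g (Next \<Gamma> \<phi>) \<longleftrightarrow>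
     (\<exists>\<sigma>\<in>joint_strategies F M \<Gamma>. outcomes F M g \<Gamma> \<sigma> \<noteq> {} \<and>
        (\<forall>\<pi>\<in>outcomes F M g \<Gamma> \<sigma>. sat F M (fst \<pi> 1) \<phi>))"
| "sat F M g (Globally \<Gamma> \<phi>) \<longleftrightarrow>
     (\<exists>\<sigma>\<in>joint_strategies F M \<Gamma>. outcomes F M g \<Gamma> \<sigma> \<noteq> {} \<and>
        (\<forall>\<pi>\<in>outcomes F M g \<Gamma> \<sigma>. \<forall>i. sat F M (fst \<pi> i) \<phi>))"
| "sat F M g (Until \<Gamma> \<phi> \<psi>) \<longleftrightarrow>
     (\<exists>\<sigma>\<in>joint_strategies F M \<Gamma>. outcomes F M g \<Gamma> \<sigma> \<noteq> {} \<and>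
        (\<forall>\<pi>\<in>outcomes F M g \<Gamma> \<sigma>. \<exists>i. sat F M (fst \<pi> i) \<psi> \<and> (\<forall>j<i. sat F M (fst \<pi> j) \<phi>)))"

text \<open>The coordinates of a bit vector are addressed by name: \<open>TBvar i l a\<close> is the entry
  $(l,a)$ of the table of agent $i$, and \<open>VBvar g p\<close> is the entry $(g,p)$ of the valuation
  vector. A bit vector is an extensional function from the set of all variables to the truth
  values.\<close>

datatype 'p bvar = TBvar nat lstate laction | VBvar gstate 'p

type_synonym 'p bitvec = "'p bvar \<Rightarrow> bool"

definition TB :: "'p frame \<Rightarrow> nat \<Rightarrow> 'p bvar set" where
  "TB F i = {TBvar i l a | l a. l \<in> lstates F i \<and> a \<in> lactions F i}"

definition VB :: "'p frame \<Rightarrow> 'p bvar set" where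
  "VB F = {VBvar g p | g p. g \<in> gstates F \<and> p \<in> props F}"

definition bvars :: "'p frame \<Rightarrow> 'p bvar set" where
  "bvars F = (\<Union>i\<in>agents F. TB F i) \<union> VB F"

definition encode :: "'p frame \<Rightarrow> 'p model \<Rightarrow> 'p bitvec" where
  "encode F M = (\<lambda>x\<in>bvars F. case x of TBvar i l a \<Rightarrow> a \<in> prot M i l | VBvar g p \<Rightarrow> p \<in> val M g)"

definition model_vectors :: "'p frame \<Rightarrow> 'p bitvec set" where
  "model_vectors F = encode F ` models F"

text \<open>The model encoded by a vector is unique, see \<open>inj_on_encode\<close> below.\<close>

definition model_of :: "'p frame \<Rightarrow> 'p bitvec \<Rightarrow> 'p model" where
  "model_of F v = (THE M. M \<in> models F \<and> encode F M = v)"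

definition solve :: "'p frame \<Rightarrow> 'p atl \<Rightarrow> 'p bitvec \<Rightarrow> gstate set" where
  "solve F \<phi> v = {g \<in> gstates F. sat F (model_of F v) g \<phi>}"

text \<open>Monotonicity of a set-valued function \<open>f\<close> whose arguments range over a set \<open>D\<close> of
  admissible bit vectors; both the original and the modified vector have to lie in \<open>D\<close>.\<close>

definition pos_monotonic :: "('x \<Rightarrow> bool) set \<Rightarrow> (('x \<Rightarrow> bool) \<Rightarrow> 's set) \<Rightarrow> 'x set \<Rightarrow> bool" where
  "pos_monotonic D f W \<longleftrightarrow>
     (\<forall>v\<in>D. \<forall>x\<in>W. \<not> v x \<longrightarrow> v(x := True) \<in> D \<longrightarrow> f v \<subseteq> f (v(x := True)))"

definition neg_monotonic :: "('x \<Rightarrow> bool) set \<Rightarrow> (('x \<Rightarrow> bool) \<Rightarrow> 's set) \<Rightarrow> 'x set \<Rightarrow> bool" where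
  "neg_monotonic D f W \<longleftrightarrow>
     (\<forall>v\<in>D. \<forall>x\<in>W. v x \<longrightarrow> v(x := False) \<in> D \<longrightarrow> f v \<subseteq> f (v(x := False)))"

lemma encode_TBvar:
  assumes "i \<in> agents F" "l \<in> lstates F i" "a \<in> lactions F i"
  shows "encode F M (TBvar i l a) \<longleftrightarrow> a \<in> prot M i l"
  using assms by (auto simp: encode_def bvars_def TB_def)

lemma encode_VBvar:
  assumes "g \<in> gstates F" "p \<in> props F"
  shows "encode F M (VBvar g p) \<longleftrightarrow> p \<in> val M g"
  using assms by (auto simp: encode_def bvars_def VB_def)

lemma inj_on_encode: "inj_on (encode F) (models F)"
proof (rule inj_onI)
  fix M N assume M: "M \<in> models F" and N: "N \<in> models F" and eq: "encode F M = encode F N"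
  have PM: "prot M \<in> (\<Pi>\<^sub>E i\<in>agents F. \<Pi>\<^sub>E l\<in>lstates F i. Pow (lactions F i) - {{}})"
    and PN: "prot N \<in> (\<Pi>\<^sub>E i\<in>agents F. \<Pi>\<^sub>E l\<in>lstates F i. Pow (lactions F i) - {{}})"
    and VM: "val M \<in> gstates F \<rightarrow>\<^sub>E Pow (props F)"
    and VN: "val N \<in> gstates F \<rightarrow>\<^sub>E Pow (props F)"
    using M N by (auto simp: models_def)
  have "prot M = prot N"
  proof (rule PiE_ext[OF PM PN])
    fix i assume i: "i \<in> agents F"
    show "prot M i = prot N i"
    proof (rule PiE_ext[OF PiE_mem[OF PM i] PiE_mem[OF PN i]])
      fix l assume l: "l \<in> lstates F i"
      have "prot M i l \<subseteq> lactions F i" "prot N i l \<subseteq> lactions F i"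
        using PiE_mem[OF PiE_mem[OF PM i] l] PiE_mem[OF PiE_mem[OF PN i] l] by auto
      moreover have "a \<in> prot M i l \<longleftrightarrow> a \<in> prot N i l" if "a \<in> lactions F i" for a
        using encode_TBvar[OF i l that] eq by metis
      ultimately show "prot M i l = prot N i l" by blast
    qed
  qed
  moreover have "val M = val N"
  proof (rule PiE_ext[OF VM VN])
    fix g assume g: "g \<in> gstates F"
    have "val M g \<subseteq> props F" "val N g \<subseteq> props F"
      using PiE_mem[OF VM g] PiE_mem[OF VN g] by auto
    moreover have "p \<in> val M g \<longleftrightarrow> p \<in> val N g" if "p \<in> props F" for p
      using encode_VBvar[OF g that] eq by metis
    ultimately show "val M g = val N g" by blast
  qed
  ultimately show "M = N" by simp
qed

lemma model_of_encode: "M \<in> models F \<Longrightarrow> model_of F (encode F M) = M"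
  unfolding model_of_def using inj_on_encode[of F] by (auto simp: inj_on_def)

lemma model_vectors_iff:
  "v \<in> model_vectors F \<longleftrightarrow>
     v \<in> extensional (bvars F) \<and>
     (\<forall>i\<in>agents F. \<forall>l\<in>lstates F i. \<exists>a\<in>lactions F i. v (TBvar i l a))"
proof
  assume "v \<in> model_vectors F"
  then obtain M where M: "M \<in> models F" and v: "v = encode F M"
    by (auto simp: model_vectors_def)
  have "\<exists>a\<in>lactions F i. v (TBvar i l a)" if i: "i \<in> agents F" and l: "l \<in> lstates F i" for i l
  proof -
    have "prot M i l \<in> Pow (lactions F i) - {{}}"
      using M i l by (auto simp: models_def PiE_iff)
    then obtain a where "a \<in> lactions F i" "a \<in> prot M i l" by blast
    then show ?thesis using encode_TBvar[OF i l] v by blast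
  qed
  then show "v \<in> extensional (bvars F) \<and>
     (\<forall>i\<in>agents F. \<forall>l\<in>lstates F i. \<exists>a\<in>lactions F i. v (TBvar i l a))"
    by (simp add: v encode_def)
next
  assume v: "v \<in> extensional (bvars F) \<and>
     (\<forall>i\<in>agents F. \<forall>l\<in>lstates F i. \<exists>a\<in>lactions F i. v (TBvar i l a))"
  define M where "M = \<lparr>prot = (\<lambda>i\<in>agents F. \<lambda>l\<in>lstates F i. {a \<in> lactions F i. v (TBvar i l a)}),
     val = (\<lambda>g\<in>gstates F. {p \<in> props F. v (VBvar g p)})\<rparr>"
  have "M \<in> models F"
    using v by (auto simp: models_def M_def) blast
  moreover have "encode F M = v"
  proof
    fix x show "encode F M x = v x"
      using v by (auto simp: encode_def M_def bvars_def TB_def VB_def extensional_def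
          split: bvar.split)
  qed
  ultimately show "v \<in> model_vectors F" by (auto simp: model_vectors_def)
qed

end

theory Submission
  imports Defs
begin

text \<open>Give the members of \<open>\<Gamma>\<close> more actions, their opponents fewer, and enlarge the
  valuation. Every joint strategy of \<open>\<Gamma>\<close> is still a joint strategy, and since its actions were
  already permitted for \<open>\<Gamma>\<close> before the change, its outcome set can only shrink. It does not become
  empty because no protocol is ever empty. Hence a witnessing strategy for a temporal formula remains
  a witness.\<close>

text \<open>A single relation serves every temporal case: setting a valuation bit, setting a table
  bit of a member of \<Gamma> and clearing one of an opponent are all instances.\<close>

definition favours :: "'p frame \<Rightarrow> nat set \<Rightarrow> 'p model \<Rightarrow> 'p model \<Rightarrow> bool" where
  "favours F \<Gamma> M N \<longleftrightarrow>
     (\<forall>i\<in>\<Gamma>. \<forall>l\<in>lstates F i. prot M i l \<subseteq> prot N i l) \<and>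
     (\<forall>i\<in>agents F - \<Gamma>. \<forall>l\<in>lstates F i. prot N i l \<subseteq> prot M i l) \<and>
     (\<forall>g\<in>gstates F. val M g \<subseteq> val N g)"

lemma gstates_lstates: "g \<in> gstates F \<Longrightarrow> i \<in> agents F \<Longrightarrow> g i \<in> lstates F i"
  by (auto simp: gstates_def)

lemma prot_models:
  assumes "M \<in> models F" "i \<in> agents F" "l \<in> lstates F i"
  shows "prot M i l \<subseteq> lactions F i" "prot M i l \<noteq> {}"
proof -
  have "prot M i l \<in> Pow (lactions F i) - {{}}"
    using assms by (auto simp: models_def PiE_iff)
  then show "prot M i l \<subseteq> lactions F i" "prot M i l \<noteq> {}" by auto
qed

lemma val_models: "M \<in> models F \<Longrightarrow> g \<in> gstates F \<Longrightarrow> val M g \<subseteq> props F"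
  by (auto simp: models_def PiE_iff)

lemma outcomes_gstates: "\<pi> \<in> outcomes F M g \<Gamma> \<sigma> \<Longrightarrow> fst \<pi> k \<in> gstates F"
  by (auto simp: outcomes_def paths_def gtrans_def)

lemma joint_strategies_prot:
  assumes "\<sigma> \<in> joint_strategies F M \<Gamma>" "i \<in> \<Gamma>" "g \<in> gstates F"
  shows "\<sigma> i g \<in> prot M i (g i)"
  using assms by (auto simp: joint_strategies_def strategies_def PiE_iff)

text \<open>Opponents always have some permitted action, so letting \<Gamma> follow \<sigma>, fixing
  such a choice for the others and iterating from \<open>g\<close> produces a path.\<close>

lemma outcomes_nonempty:
  assumes M: "M \<in> models F" and \<sigma>: "\<sigma> \<in> joint_strategies F M \<Gamma>" and g: "g \<in> gstates F"
    and \<Gamma>: "\<Gamma> \<subseteq> agents F"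
  shows "outcomes F M g \<Gamma> \<sigma> \<noteq> {}"
proof -
  \<comment> \<open>Local transitions lead to the state carrying the index of the action, so \<open>step h\<close> is both the
    global action chosen at \<open>h\<close> and its successor state.\<close>
  define step where
    "step h = (\<lambda>i\<in>agents F. if i \<in> \<Gamma> then \<sigma> i h else SOME a. a \<in> prot M i (h i))" for h
  have step_prot: "step h i \<in> prot M i (h i)" if "h \<in> gstates F" "i \<in> agents F" for h i
    using that joint_strategies_prot[OF \<sigma>] prot_models(2)[OF M _ gstates_lstates]
    by (simp add: step_def some_in_eq)
  then have step_act: "step h \<in> gactions F" if "h \<in> gstates F" for h
    using that prot_models(1)[OF M _ gstates_lstates] by (fastforce simp: gactions_def step_def)
  \<comment> \<open>\<open>lactions\<close> and \<open>lstates\<close> are the same interval, so a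
    global action is literally a global state.\<close>
  then have step_state: "step h \<in> gstates F" if "h \<in> gstates F" for h
    using that by (simp add: gactions_def gstates_def lactions_def lstates_def)
  define gs where "gs k = (step ^^ k) g" for k
  have gs: "gs k \<in> gstates F" for k
    by (induction k) (simp_all add: gs_def g step_state)
  have gs_Suc: "gs (Suc k) = step (gs k)" for k
    by (simp add: gs_def)
  have "(gs, \<lambda>k. step (gs k)) \<in> paths F M g"
    using gs step_act step_state step_prot
    by (auto simp: paths_def gtrans_def ltrans_def gs_Suc) (simp add: gs_def)
  moreover have "step (gs k) j = \<sigma> j (gs k)" if "j \<in> \<Gamma>" for k j
    using that \<Gamma> by (auto simp: step_def)
  ultimately have "(gs, \<lambda>k. step (gs k)) \<in> outcomes F M g \<Gamma> \<sigma>"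
    by (simp add: outcomes_def)
  then show ?thesis by blast
qed

lemma favours_joint_strategies:
  assumes "favours F \<Gamma> M N" "\<Gamma> \<subseteq> agents F" "\<sigma> \<in> joint_strategies F M \<Gamma>"
  shows "\<sigma> \<in> joint_strategies F N \<Gamma>"
proof -
  have "\<sigma> i g \<in> prot N i (g i)" if "i \<in> \<Gamma>" "g \<in> gstates F" for i g
    using that assms joint_strategies_prot[OF assms(3) that] gstates_lstates[OF that(2), of i]
    by (auto simp: favours_def)
  then show ?thesis
    using assms(3) by (simp add: joint_strategies_def strategies_def PiE_iff)
qed

text \<open>A transition of \<open>N\<close> can fail in \<open>M\<close> only through an action
  that \<open>M\<close> forbids. Opponents gained no action in \<open>N\<close>, and members play
  \<sigma>, whose choices \<open>M\<close> permits.\<close>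

lemma favours_outcomes:
  assumes fav: "favours F \<Gamma> M N" and \<sigma>: "\<sigma> \<in> joint_strategies F M \<Gamma>"
  shows "outcomes F N g \<Gamma> \<sigma> \<subseteq> outcomes F M g \<Gamma> \<sigma>"
proof
  fix \<pi> assume \<pi>: "\<pi> \<in> outcomes F N g \<Gamma> \<sigma>"
  obtain gs as where \<pi>_eq: "\<pi> = (gs, as)" by force
  have tr: "gtrans F N (gs k) (as k) (gs (Suc k))" for k
    using \<pi> by (auto simp: \<pi>_eq outcomes_def paths_def)
  have follows: "as k j = \<sigma> j (gs k)" if "j \<in> \<Gamma>" for k j
    using \<pi> that by (auto simp: \<pi>_eq outcomes_def)
  have "as k i \<in> prot M i (gs k i)" if i: "i \<in> agents F" for k i
  proof (cases "i \<in> \<Gamma>")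
    case True
    then show ?thesis
      using tr[of k] joint_strategies_prot[OF \<sigma>] by (simp add: follows gtrans_def)
  next
    case False
    have "as k i \<in> prot N i (gs k i)"
      using tr[of k] i by (auto simp: gtrans_def ltrans_def split: if_splits)
    moreover have "gs k i \<in> lstates F i"
      using tr[of k] i gstates_lstates by (auto simp: gtrans_def)
    ultimately show ?thesis
      using fav False i unfolding favours_def by blast
  qed
  \<comment> \<open>The successor is the action index in both models, so permission is all that had
    to be transferred.\<close>
  then have "gtrans F M (gs k) (as k) (gs (Suc k))" for k
    using tr[of k] by (auto simp: gtrans_def ltrans_def split: if_splits)
  then show "\<pi> \<in> outcomes F M g \<Gamma> \<sigma>"
    using \<pi> by (auto simp: \<pi>_eq outcomes_def paths_def)
qed

text \<open>The three temporal operators differ only in the path property, here \<open>P\<close> for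
  \<open>M\<close> and \<open>Q\<close> for \<open>N\<close>. \<open>PQ\<close> may assume states in
  \<open>gstates F\<close> because \<open>favours\<close> compares valuations only there.\<close>

lemma favours_strategic:
  assumes "favours F \<Gamma> M N" "N \<in> models F" "\<Gamma> \<subseteq> agents F" "g \<in> gstates F"
    and PQ: "\<And>\<pi>. (\<And>k. fst \<pi> k \<in> gstates F) \<Longrightarrow> P \<pi> \<Longrightarrow> Q \<pi>"
    and wit: "\<exists>\<sigma>\<in>joint_strategies F M \<Gamma>. outcomes F M g \<Gamma> \<sigma> \<noteq> {} \<and>
      (\<forall>\<pi>\<in>outcomes F M g \<Gamma> \<sigma>. P \<pi>)"
  shows "\<exists>\<sigma>\<in>joint_strategies F N \<Gamma>. outcomes F N g \<Gamma> \<sigma> \<noteq> {} \<and> (\<forall>\<pi>\<in>outcomes F N g \<Gamma> \<sigma>. Q \<pi>)"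
proof -
  obtain \<sigma> where \<sigma>: "\<sigma> \<in> joint_strategies F M \<Gamma>" "\<forall>\<pi>\<in>outcomes F M g \<Gamma> \<sigma>. P \<pi>"
    using wit by blast
  have \<sigma>N: "\<sigma> \<in> joint_strategies F N \<Gamma>"
    using favours_joint_strategies assms \<sigma> by blast
  moreover have "outcomes F N g \<Gamma> \<sigma> \<noteq> {}"
    using outcomes_nonempty \<sigma>N assms by blast
  moreover have "Q \<pi>" if "\<pi> \<in> outcomes F N g \<Gamma> \<sigma>" for \<pi>
    using that PQ outcomes_gstates[OF that] \<sigma> favours_outcomes[OF assms(1) \<sigma>(1)] by blast
  ultimately show ?thesis by blast
qed

text \<open>With atomic operands each path property is a positive condition on the valuation, so
  enlarging the valuation preserves it.\<close>

lemma sat_favours: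
  assumes fav: "favours F \<Gamma> M N" and "N \<in> models F" "\<Gamma> \<subseteq> agents F" "g \<in> gstates F"
    and \<phi>: "\<phi> \<in> {Next \<Gamma> (Prop p), Globally \<Gamma> (Prop p), Until \<Gamma> (Prop p) (Prop q)}"
    and sat: "sat F M g \<phi>"
  shows "sat F N g \<phi>"
proof -
  have mono: "r \<in> val N h" if "h \<in> gstates F" "r \<in> val M h" for r h
    using fav that by (auto simp: favours_def)
  note strategic = favours_strategic[OF assms(1-4)]
  consider "\<phi> = Next \<Gamma> (Prop p)" | "\<phi> = Globally \<Gamma> (Prop p)" | "\<phi> = Until \<Gamma> (Prop p) (Prop q)"
    using \<phi> by blast
  then show ?thesis
  proof cases
    case 1
    \<comment> \<open>\<open>rotated\<close> puts the witness premise first, so the unfolded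
      \<open>sat\<close> fixes the path property of \<open>M\<close>; only its passage to
      \<open>N\<close> remains.\<close>
    show ?thesis
      using sat unfolding 1 sat.simps by (rule strategic[rotated]) (auto intro: mono)
  next
    case 2
    show ?thesis
      using sat unfolding 2 sat.simps by (rule strategic[rotated]) (auto intro: mono)
  next
    case 3
    show ?thesis
      using sat unfolding 3 sat.simps by (rule strategic[rotated]) (use mono in blast)
  qed
qed

text \<open>Implications between bits become inclusions because protocols and valuations of models
  stay within \<open>lactions F i\<close> and \<open>props F\<close>, where each element has its own
  bit.\<close>

lemma favours_encodeI:
  assumes M: "M \<in> models F" and N: "N \<in> models F" and \<Gamma>: "\<Gamma> \<subseteq> agents F"
    and coalition: "\<And>i l a. i \<in> \<Gamma> \<Longrightarrow> encode F M (TBvar i l a) \<Longrightarrow> encode F N (TBvar i l a)"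
    and others: "\<And>i l a. i \<in> agents F - \<Gamma> \<Longrightarrow> encode F N (TBvar i l a) \<Longrightarrow> encode F M (TBvar i l a)"
    and vals: "\<And>g p. encode F M (VBvar g p) \<Longrightarrow> encode F N (VBvar g p)"
  shows "favours F \<Gamma> M N"
  unfolding favours_def
proof (intro conjI ballI subsetI)
  fix i l a assume "i \<in> \<Gamma>" "l \<in> lstates F i" "a \<in> prot M i l"
  then show "a \<in> prot N i l"
    using coalition[of i l a] prot_models(1)[OF M, of i l] \<Gamma> encode_TBvar[of i F l a] by blast
next
  fix i l a assume "i \<in> agents F - \<Gamma>" "l \<in> lstates F i" "a \<in> prot N i l"
  then show "a \<in> prot M i l"
    using others[of i l a] prot_models(1)[OF N, of i l] encode_TBvar[of i F l a] by blast
next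
  fix g p assume "g \<in> gstates F" "p \<in> val M g"
  then show "p \<in> val N g"
    using vals[of g p] val_models[OF M, of g] encode_VBvar[of g F p] by blast
qed

text \<open>The vectors may differ in many bits; a one-bit flip is the case used later. That
  \<open>w\<close> encodes a model keeps the outcome sets nonempty.\<close>

lemma solve_favours:
  assumes "v \<in> model_vectors F" "w \<in> model_vectors F" "\<Gamma> \<subseteq> agents F"
    and "\<And>i l a. i \<in> \<Gamma> \<Longrightarrow> v (TBvar i l a) \<Longrightarrow> w (TBvar i l a)"
    and "\<And>i l a. i \<in> agents F - \<Gamma> \<Longrightarrow> w (TBvar i l a) \<Longrightarrow> v (TBvar i l a)"
    and "\<And>g p. v (VBvar g p) \<Longrightarrow> w (VBvar g p)"
    and "\<phi> \<in> {Next \<Gamma> (Prop p), Globally \<Gamma> (Prop p), Until \<Gamma> (Prop p) (Prop q)}"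
  shows "solve F \<phi> v \<subseteq> solve F \<phi> w"
proof -
  obtain M N where M: "M \<in> models F" "v = encode F M" and N: "N \<in> models F" "w = encode F N"
    using assms(1,2) by (auto simp: model_vectors_def)
  have "favours F \<Gamma> M N"
    using assms(4-6) by (intro favours_encodeI[OF M(1) N(1) assms(3)]) (auto simp: M N)
  then show ?thesis
    using sat_favours[OF _ N(1) assms(3) _ assms(7)] M N by (auto simp: solve_def model_of_encode)
qed

text \<open>Atoms are read off the valuation bits alone, which settles the Boolean formulas without
  comparing models.\<close>

lemma solve_Prop:
  assumes "v \<in> model_vectors F" "p \<in> props F"
  shows "solve F (Prop p) v = {g \<in> gstates F. v (VBvar g p)}"
  using assms by (auto simp: model_vectors_def solve_def model_of_encode encode_VBvar)

lemma solve_Neg: "solve F (Neg \<phi>) v = gstates F - solve F \<phi> v"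
  by (auto simp: solve_def)

lemma solve_Conj: "solve F (Conj \<phi> \<psi>) v = solve F \<phi> v \<inter> solve F \<psi> v"
  by (auto simp: solve_def)

theorem theorem3p8:
  fixes F :: "'p frame" and p q :: 'p and \<Gamma> :: "nat set"
  assumes "finite (props F)"
    and "p \<in> props F" and "q \<in> props F" and "\<Gamma> \<subseteq> agents F"
  shows
    "(\<forall>\<phi>\<in>{Prop p, Conj (Prop p) (Prop q), Next \<Gamma> (Prop p), Globally \<Gamma> (Prop p),
           Until \<Gamma> (Prop p) (Prop q)}.
        pos_monotonic (model_vectors F) (solve F \<phi>) (VB F))
     \<and> neg_monotonic (model_vectors F) (solve F (Neg (Prop p))) (VB F)
     \<and> (\<forall>i\<in>agents F. \<forall>\<phi>\<in>{Prop p, Neg (Prop p), Conj (Prop p) (Prop q)}.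
        pos_monotonic (model_vectors F) (solve F \<phi>) (TB F i) \<and>
        neg_monotonic (model_vectors F) (solve F \<phi>) (TB F i))
     \<and> (\<forall>i\<in>\<Gamma>. \<forall>\<phi>\<in>{Next \<Gamma> (Prop p), Globally \<Gamma> (Prop p), Until \<Gamma> (Prop p) (Prop q)}.
        pos_monotonic (model_vectors F) (solve F \<phi>) (TB F i))
     \<and> (\<forall>i\<in>agents F - \<Gamma>.
        \<forall>\<phi>\<in>{Next \<Gamma> (Prop p), Globally \<Gamma> (Prop p), Until \<Gamma> (Prop p) (Prop q)}.
        neg_monotonic (model_vectors F) (solve F \<phi>) (TB F i))"
proof -
  let ?D = "model_vectors F"
  let ?S = "{Next \<Gamma> (Prop p), Globally \<Gamma> (Prop p), Until \<Gamma> (Prop p) (Prop q)}"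
  note bool = solve_Prop[OF _ assms(2)] solve_Prop[OF _ assms(3)] solve_Neg solve_Conj
  have "pos_monotonic ?D (solve F \<phi>) (VB F)" if "\<phi> \<in> ?S" for \<phi>
    unfolding pos_monotonic_def
    by (intro ballI impI solve_favours[OF _ _ assms(4) _ _ _ that]) (auto simp: VB_def)
  moreover have "pos_monotonic ?D (solve F \<phi>) (VB F)"
    if "\<phi> \<in> {Prop p, Conj (Prop p) (Prop q)}" for \<phi>
    using that by (auto simp: pos_monotonic_def bool)
  moreover have "neg_monotonic ?D (solve F (Neg (Prop p))) (VB F)"
    by (auto simp: neg_monotonic_def bool)
  \<comment> \<open>By \<open>bool\<close> these sets depend only on \<open>VBvar\<close> bits,
    which a flip in \<open>TB F i\<close> leaves unchanged, so both inclusions are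
    equalities.\<close>
  moreover have "pos_monotonic ?D (solve F \<phi>) (TB F i) \<and> neg_monotonic ?D (solve F \<phi>) (TB F i)"
    if "\<phi> \<in> {Prop p, Neg (Prop p), Conj (Prop p) (Prop q)}" for \<phi> i
    using that by (auto simp: pos_monotonic_def neg_monotonic_def bool TB_def)
  \<comment> \<open>The flipped bit belongs to a member, so the implication for opponents concerns
    unchanged bits. Clearing a bit of an opponent is the mirror image.\<close>
  moreover have "pos_monotonic ?D (solve F \<phi>) (TB F i)" if "i \<in> \<Gamma>" "\<phi> \<in> ?S" for \<phi> i
    unfolding pos_monotonic_def
    by (intro ballI impI solve_favours[OF _ _ assms(4) _ _ _ that(2)])
      (use that(1) in \<open>auto simp: TB_def split: if_splits\<close>)
  moreover have "neg_monotonic ?D (solve F \<phi>) (TB F i)" if "i \<in> agents F - \<Gamma>" "\<phi> \<in> ?S" for \<phi> i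
    unfolding neg_monotonic_def
    by (intro ballI impI solve_favours[OF _ _ assms(4) _ _ _ that(2)])
      (use that(1) in \<open>auto simp: TB_def split: if_splits\<close>)
  ultimately show ?thesis by simp
qed

end
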